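(* Let $p$ be a prime, let $q=p^e$ with $q\equiv 1 \pmod 3$, and let $G$ be the transitive permutation group arising from $\mathrm{PSL}(2,q)$ acting on the left cosets of a subgroup of order $3$. Then $\rho(G)=4/3$ if $p\neq 5$, and $\rho(G)=2$ if $p=5$.
   Context: For a permutation group $G$ on a finite set $V$, a subset $\mathcal{F}\subseteq G$ is intersecting if for all $g,h\in\mathcal{F}$ there is $v\in V$ with $g(v)=h(v)$. The intersection density $\rho(G)$ is the maximum of $|\mathcal{F}|/\max\{|G_v|: v\in V\}$ over all intersecting sets $\mathcal{F}$ of $G$, where $G_v$ is the stabilizer of $v$. *)

theory Defs
  imports "HOL-Algebra.Algebra" "HOL-Computational_Algebra.Primes"
begin

text \<open>2x2 matrices over a field, written as (a,b,c,d) for the matrix [[a,b],[c,d]].\<close>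
type_synonym 'a mat2 = "'a \<times> 'a \<times> 'a \<times> 'a"

definition mat2_mult :: "'a::comm_ring_1 mat2 \<Rightarrow> 'a mat2 \<Rightarrow> 'a mat2" where
  "mat2_mult A B = (case A of (a,b,c,d) \<Rightarrow> (case B of (x,y,z,w) \<Rightarrow>
      (a*x + b*z, a*y + b*w, c*x + d*z, c*y + d*w)))"

definition mat2_det :: "'a::comm_ring_1 mat2 \<Rightarrow> 'a" where
  "mat2_det A = (case A of (a,b,c,d) \<Rightarrow> a * d - b * c)"

definition SL2 :: "'a::field mat2 monoid" where
  "SL2 = \<lparr>carrier = {A. mat2_det A = 1}, monoid.mult = mat2_mult, one = (1,0,0,1)\<rparr>"

definition PSL2 :: "'a::field mat2 set monoid" where
  "PSL2 = SL2 Mod {(1,0,0,1), (-1,0,0,-1)}"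

definition coset_space :: "('b, 'm) monoid_scheme \<Rightarrow> 'b set \<Rightarrow> 'b set set" where
  "coset_space G H = {a <#\<^bsub>G\<^esub> H | a. a \<in> carrier G}"

definition coset_action :: "('b, 'm) monoid_scheme \<Rightarrow> 'b set \<Rightarrow> 'b \<Rightarrow> 'b set \<Rightarrow> 'b set" where
  "coset_action G H g = (\<lambda>C. if C \<in> coset_space G H then g <#\<^bsub>G\<^esub> C else C)"

definition coset_perm_group :: "('b, 'm) monoid_scheme \<Rightarrow> 'b set \<Rightarrow> ('b set \<Rightarrow> 'b set) set" where
  "coset_perm_group G H = coset_action G H ` carrier G"

definition intersecting_set :: "'v set \<Rightarrow> ('v \<Rightarrow> 'v) set \<Rightarrow> bool" where
  "intersecting_set V F \<longleftrightarrow> (\<forall>g\<in>F. \<forall>h\<in>F. \<exists>v\<in>V. g v = h v)"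

definition point_stabilizer :: "('v \<Rightarrow> 'v) set \<Rightarrow> 'v \<Rightarrow> ('v \<Rightarrow> 'v) set" where
  "point_stabilizer G v = {g \<in> G. g v = v}"

definition intersection_density :: "'v set \<Rightarrow> ('v \<Rightarrow> 'v) set \<Rightarrow> real" where
  "intersection_density V G =
     real (Max {card F | F. F \<subseteq> G \<and> intersecting_set V F})
     / real (Max {card (point_stabilizer G v) | v. v \<in> V})"

end

theory Submission
  imports Defs "HOL-Number_Theory.Residues"
begin

text \<open>
  Since \<open>q\<close> is 1 modulo 3, all elements of order 3 of \<open>PSL(2,q)\<close> are conjugate, so a set is
  intersecting iff all quotients of its members have trivial cube, and the density is a third of the
  largest size of such a set. A matrix of determinant 1 has trivial cube in \<open>PSL(2,q)\<close> iff it is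
  \<open>\<plusminus>1\<close> or has trace \<open>\<plusminus>1\<close>. Now \<open>tr (A\<inverse> B)\<close> is the polar form of the determinant, so an
  intersecting set is a set of lines spanned by vectors of norm 2 and mutual inner products \<open>\<plusminus>1\<close> in a
  quadratic space of dimension 4. Five such vectors have a singular Gram matrix; its determinant is,
  up to sign, one of 2, 6, 10, 18, 54, 162, and 10 is the only one that vanishes in some
  characteristic other than 2 and 3, namely in characteristic 5. There the sign patterns with vanishing
  determinant satisfy a parity condition which rules out seven vectors, while six exist.
  In characteristic 2 the linear relation between five vectors contradicts the quadratic form.
\<close>

section \<open>Equiangular vectors in the space of two by two matrices\<close>

text \<open>Gaussian elimination, one equation per induction step: if equation \<open>j\<close> has
  a nonzero coefficient at a pivot \<open>k\<close>, both are removed and the value at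
  \<open>k\<close> is solved for afterwards.\<close>

lemma nontrivial_linear_relation:
  fixes v :: "'i \<Rightarrow> 'j \<Rightarrow> 'a::field"
  assumes "finite J" "finite I" "card J < card I"
  shows "\<exists>c. (\<exists>i\<in>I. c i \<noteq> 0) \<and> (\<forall>j\<in>J. (\<Sum>i\<in>I. c i * v i j) = 0)"
  using assms
proof (induction J arbitrary: I v rule: finite_induct)
  case empty
  then have "I \<noteq> {}" by auto
  then show ?case by (intro exI[of _ "\<lambda>_. 1"]) auto
next
  case (insert j J)
  show ?case
  proof (cases "\<forall>i\<in>I. v i j = 0")
    case True
    have "card J < card I" using insert by simp
    from insert.IH[OF \<open>finite I\<close> this, of v] True show ?thesis by auto
  next
    case False
    then obtain k where k: "k \<in> I" "v k j \<noteq> 0" by blast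
    define w where "w i l = v i l - v i j / v k j * v k l" for i l
    have "card J < card (I - {k})" using insert k by simp
    from insert.IH[OF _ this, of w] \<open>finite I\<close> obtain c
      where c: "\<exists>i\<in>I - {k}. c i \<noteq> 0" "\<And>l. l \<in> J \<Longrightarrow> (\<Sum>i\<in>I - {k}. c i * w i l) = 0"
      by auto
    \<comment> \<open>Back substitution: equation \<open>j\<close> forces the value at the
      pivot.\<close>
    define d where "d = c(k := - (\<Sum>i\<in>I - {k}. c i * v i j) / v k j)"
    have split: "(\<Sum>i\<in>I. d i * v i l) = d k * v k l + (\<Sum>i\<in>I - {k}. c i * v i l)" for l
      using \<open>finite I\<close> k by (simp add: sum.remove[of I k] d_def)
    have "(\<Sum>i\<in>I. d i * v i j) = 0"
      unfolding split using k by (simp add: d_def)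
    moreover have "(\<Sum>i\<in>I. d i * v i l) = 0" if "l \<in> J" for l
    proof -
      have "(\<Sum>i\<in>I - {k}. c i * v i l)
          = (\<Sum>i\<in>I - {k}. c i * w i l) + (\<Sum>i\<in>I - {k}. c i * v i j) / v k j * v k l"
        unfolding w_def sum_divide_distrib sum_distrib_right sum.distrib[symmetric]
        by (rule sum.cong) (auto simp: algebra_simps)
      then show ?thesis
        unfolding split using c(2)[OF that] by (simp add: d_def)
    qed
    moreover have "\<exists>i\<in>I. d i \<noteq> 0" using c(1) by (auto simp: d_def)
    ultimately show ?thesis by blast
  qed
qed

section \<open>Trace, polar form and Gram determinants\<close>

definition mat2_tr :: "'a::comm_ring_1 mat2 \<Rightarrow> 'a" where
  "mat2_tr A = (case A of (a,b,c,d) \<Rightarrow> a + d)"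

text \<open>The polar form of the determinant; for \<open>A\<close> of determinant 1 it equals \<open>tr (A\<inverse> B)\<close>.\<close>
definition mat2_form :: "'a::comm_ring_1 mat2 \<Rightarrow> 'a mat2 \<Rightarrow> 'a" where
  "mat2_form A B = (case A of (a,b,c,d) \<Rightarrow> (case B of (x,y,z,w) \<Rightarrow> d*x - b*z - c*y + a*w))"

lemma mat2_form_sym: "mat2_form A B = mat2_form B A"
  by (cases A; cases B) (simp add: mat2_form_def algebra_simps)

text \<open>The determinant of the symmetric 4 by 4 matrix with diagonal entries \<open>-3\<close> and the given
  off-diagonal entries. It arises from the projections \<open>2 A - 1\<close> of matrices of trace 1 to the
  three-dimensional space of traceless matrices.\<close>
definition gram_det :: "'a::comm_ring_1 \<Rightarrow> 'a \<Rightarrow> 'a \<Rightarrow> 'a \<Rightarrow> 'a \<Rightarrow> 'a \<Rightarrow> 'a" where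
  "gram_det t12 t13 t14 t23 t24 t34 =
     81 - 9 * (t12^2 + t13^2 + t14^2 + t23^2 + t24^2 + t34^2)
     - 6 * (t12*t13*t23 + t12*t14*t24 + t13*t14*t34 + t23*t24*t34)
     + (t12*t34)^2 + (t13*t24)^2 + (t14*t23)^2
     - 2 * (t12*t34*t13*t24 + t12*t34*t14*t23 + t13*t24*t14*t23)"

text \<open>Cramer's rule: the hypotheses are the rows of the matrix of \<open>gram_det\<close>
  applied to the vector of the \<open>k\<close>s, and weighting them with the cofactors of the first
  column isolates \<open>k1\<close> times the determinant.\<close>

lemma gram_det_relation:
  fixes k1 :: "'a::comm_ring_1"
  assumes "- 3*k1 + k2*t12 + k3*t13 + k4*t14 = 0"
      and "k1*t12 - 3*k2 + k3*t23 + k4*t24 = 0"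
      and "k1*t13 + k2*t23 - 3*k3 + k4*t34 = 0"
      and "k1*t14 + k2*t24 + k3*t34 - 3*k4 = 0"
  shows "k1 * gram_det t12 t13 t14 t23 t24 t34 = 0"
proof -
  have "k1 * gram_det t12 t13 t14 t23 t24 t34 =
      (- 3*k1 + k2*t12 + k3*t13 + k4*t14)
        * (- 3 * (9 - t34*t34) - t23 * (- 3*t23 - t34*t24) + t24 * (t23*t34 + 3*t24))
    - (k1*t12 - 3*k2 + k3*t23 + k4*t24)
        * (t12 * (9 - t34*t34) - t23 * (- 3*t13 - t34*t14) + t24 * (t13*t34 + 3*t14))
    + (k1*t13 + k2*t23 - 3*k3 + k4*t34)
        * (t12 * (- 3*t23 - t34*t24) + 3 * (- 3*t13 - t34*t14) + t24 * (t13*t24 - t23*t14))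
    - (k1*t14 + k2*t24 + k3*t34 - 3*k4)
        * (t12 * (t23*t34 + 3*t24) + 3 * (t13*t34 + 3*t14) + t23 * (t13*t24 - t23*t14))"
    by (simp add: gram_det_def algebra_simps power2_eq_square)
  then show ?thesis using assms by simp
qed

text \<open>The values \<open>a i\<close>, \<open>b i\<close>, \<open>z i\<close> encode the trace 1
  matrix (a, b, z, 1-a), and \<open>s\<close> is the polar form of two of these. The four traceless
  matrices \<open>2 A - 1\<close> live in dimension three, so a linear relation between them is a
  nonzero kernel vector of their Gram matrix, whose entries are
  \<open>1 - 2 * s i j\<close>.\<close>

lemma gram_det_eq_0:
  fixes a b z :: "nat \<Rightarrow> 'a::field"
  defines "s \<equiv> \<lambda>i j. a i + a j - 2 * a i * a j - b i * z j - z i * b j"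
  assumes det: "\<And>i. i < 4 \<Longrightarrow> a i * (1 - a i) - b i * z i = 1"
  shows "gram_det (1 - 2 * s 0 1) (1 - 2 * s 0 2) (1 - 2 * s 0 3)
           (1 - 2 * s 1 2) (1 - 2 * s 1 3) (1 - 2 * s 2 3) = 0" (is "?D = 0")
proof -
  \<comment> \<open>The entries of the traceless matrix \<open>2 A - 1\<close>, with the factor 2
    dropped from the off-diagonal ones.\<close>
  define v where "v i j = (if j = 0 then 2 * a i - 1 else if j = 1 then b i else z i)" for i j :: nat
  obtain k where nz: "\<exists>i\<in>{..<4}. k i \<noteq> 0" and rel: "\<And>j. j < 3 \<Longrightarrow> (\<Sum>i<4. k i * v i j) = 0"
    using nontrivial_linear_relation[of "{..<3::nat}" "{..<4::nat}" v] by auto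
  have pair: "(\<Sum>i<4. k i * ((2 * a i - 1) * (2 * a j - 1) + 2 * (b i * z j + z i * b j))) = 0" for j
  proof -
    have "(\<Sum>i<4. k i * ((2 * a i - 1) * (2 * a j - 1) + 2 * (b i * z j + z i * b j)))
        = (\<Sum>i<4. k i * v i 0) * (2 * a j - 1)
          + 2 * z j * (\<Sum>i<4. k i * v i 1) + 2 * b j * (\<Sum>i<4. k i * v i 2)"
      unfolding sum_distrib_left sum_distrib_right sum.distrib[symmetric]
      by (rule sum.cong) (auto simp: v_def algebra_simps)
    then show ?thesis using rel[of 0] rel[of 1] rel[of 2] by simp
  qed
  have off: "(2 * a i - 1) * (2 * a j - 1) + 2 * (b i * z j + z i * b j) = 1 - 2 * s i j" for i j
    by (simp add: s_def algebra_simps)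
  have diag: "1 - 2 * s i i = - 3" if "i < 4" for i
  proof -
    have "1 - 2 * s i i = 1 - 4 * (a i * (1 - a i) - b i * z i)"
      by (simp add: s_def algebra_simps)
    then show ?thesis using det[OF that] by simp
  qed
  have sym: "s i j = s j i" for i j by (simp add: s_def algebra_simps)
  define t where "t i j = 1 - 2 * s i j" for i j
  have tsym: "t i j = t j i" for i j using sym[of i j] by (simp add: t_def)
  have tdiag: "t 0 0 = - 3" "t 1 1 = - 3" "t 2 2 = - 3" "t 3 3 = - 3"
    using diag by (auto simp: t_def)
  have row: "k 0 * t 0 j + k 1 * t 1 j + k 2 * t 2 j + k 3 * t 3 j = 0" for j
    using pair[of j] unfolding off t_def[symmetric]
    by (simp add: eval_nat_numeral add.assoc)
  have rows:
    "- 3 * k 0 + k 1 * t 0 1 + k 2 * t 0 2 + k 3 * t 0 3 = 0"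
    "k 0 * t 0 1 - 3 * k 1 + k 2 * t 1 2 + k 3 * t 1 3 = 0"
    "k 0 * t 0 2 + k 1 * t 1 2 - 3 * k 2 + k 3 * t 2 3 = 0"
    "k 0 * t 0 3 + k 1 * t 1 3 + k 2 * t 2 3 - 3 * k 3 = 0"
    using row[of 0] row[of 1] row[of 2] row[of 3]
    unfolding tdiag tsym[of 1 0] tsym[of 2 0] tsym[of 3 0] tsym[of 2 1] tsym[of 3 1] tsym[of 3 2]
    by (simp_all add: algebra_simps)
  \<comment> \<open>It is unknown which coefficient is nonzero, so each index in turn plays the
    first one; \<open>gram_det\<close> is invariant under renumbering.\<close>
  have "k 0 * ?D = 0"
    using gram_det_relation[OF rows] by (simp add: t_def)
  moreover have "k 1 * ?D = 0"
    using gram_det_relation[of "k 1" "k 0" "t 0 1" "k 2" "t 1 2" "k 3" "t 1 3" "t 0 2" "t 0 3" "t 2 3"] rows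
    by (simp add: t_def gram_det_def algebra_simps)
  moreover have "k 2 * ?D = 0"
    using gram_det_relation[of "k 2" "k 0" "t 0 2" "k 1" "t 1 2" "k 3" "t 2 3" "t 0 1" "t 0 3" "t 1 3"] rows
    by (simp add: t_def gram_det_def algebra_simps)
  moreover have "k 3 * ?D = 0"
    using gram_det_relation[of "k 3" "k 0" "t 0 3" "k 1" "t 1 3" "k 2" "t 2 3" "t 0 1" "t 0 2" "t 1 2"] rows
    by (simp add: t_def gram_det_def algebra_simps)
  moreover have "k 0 \<noteq> 0 \<or> k 1 \<noteq> 0 \<or> k 2 \<noteq> 0 \<or> k 3 \<noteq> 0"
    using nz by (auto simp: eval_nat_numeral less_Suc_eq)
  ultimately show ?thesis by auto
qed

text \<open>In characteristic 2 the matrices \<open>2 A - 1\<close> carry no information. Instead,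
  the identity and the four matrices satisfy a linear relation in dimension four. The polar form is
  now alternating, and pairing the relation with each matrix makes all coefficients equal. So the
  last matrix is the sum of the identity and the other three, and its determinant comes out as 0
  instead of 1.\<close>

lemma no_four_trace_1_char_2:
  fixes a b z :: "nat \<Rightarrow> 'a::field"
  assumes two: "(2::'a) = 0"
    and det: "\<And>i. i < 4 \<Longrightarrow> a i * (1 - a i) - b i * z i = 1"
    and off: "\<And>i j. i < 4 \<Longrightarrow> j < 4 \<Longrightarrow> i \<noteq> j \<Longrightarrow> a i + a j - 2 * a i * a j - b i * z j - z i * b j = 1"
  shows False
proof -
  \<comment> \<open>Index 4 stands for the identity matrix; the columns are the four matrix
    entries.\<close>
  define v where "v i j = (if i < 4 then if j = 0 then a i else if j = 1 then b i
      else if j = 2 then z i else 1 - a i else if j = 0 \<or> j = 3 then 1 else 0)" for i j :: nat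
  obtain k where nz: "\<exists>i\<in>{..<5}. k i \<noteq> 0" and rel: "\<And>j. j < 4 \<Longrightarrow> (\<Sum>i<5. k i * v i j) = 0"
    using nontrivial_linear_relation[of "{..<4::nat}" "{..<5::nat}" v] by auto
  have neg: "- x = x" for x :: 'a
    using two by (metis add_eq_0_iff2 mult_2 mult_zero_left)
  have r0: "k 0 * a 0 + k 1 * a 1 + k 2 * a 2 + k 3 * a 3 + k 4 = 0"
   and r1: "k 0 * b 0 + k 1 * b 1 + k 2 * b 2 + k 3 * b 3 = 0"
   and r2: "k 0 * z 0 + k 1 * z 1 + k 2 * z 2 + k 3 * z 3 = 0"
   and r3: "k 0 * (1 - a 0) + k 1 * (1 - a 1) + k 2 * (1 - a 2) + k 3 * (1 - a 3) + k 4 = 0"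
    using rel[of 0] rel[of 1] rel[of 2] rel[of 3]
    by (simp_all add: v_def eval_nat_numeral add.assoc)
  \<comment> \<open>The trace of the relation: the identity contributes a multiple of 2.\<close>
  have tr: "k 0 + k 1 + k 2 + k 3 = 0"
  proof -
    have "k 0 + k 1 + k 2 + k 3 + 2 * k 4
        = (k 0 * a 0 + k 1 * a 1 + k 2 * a 2 + k 3 * a 3 + k 4)
        + (k 0 * (1 - a 0) + k 1 * (1 - a 1) + k 2 * (1 - a 2) + k 3 * (1 - a 3) + k 4)"
      by (simp add: algebra_simps)
    then show ?thesis unfolding r0 r3 using two by simp
  qed
  define s where "s i j = a i + a j - 2 * a i * a j - b i * z j - z i * b j" for i j
  \<comment> \<open>The relation paired with the matrix \<open>j\<close>; the polar form of the
    identity with it is its trace 1, hence the bare \<open>k 4\<close>.\<close>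
  have pair: "k 0 * s 0 j + k 1 * s 1 j + k 2 * s 2 j + k 3 * s 3 j + k 4 = 0" for j
  proof -
    have "k 0 * s 0 j + k 1 * s 1 j + k 2 * s 2 j + k 3 * s 3 j + k 4
        = (k 0 * a 0 + k 1 * a 1 + k 2 * a 2 + k 3 * a 3 + k 4)
          + (k 0 + k 1 + k 2 + k 3) * a j
          - 2 * (k 0 * a 0 + k 1 * a 1 + k 2 * a 2 + k 3 * a 3) * a j
          - z j * (k 0 * b 0 + k 1 * b 1 + k 2 * b 2 + k 3 * b 3)
          - b j * (k 0 * z 0 + k 1 * z 1 + k 2 * z 2 + k 3 * z 3)"
      by (simp add: s_def algebra_simps)
    then show ?thesis unfolding r0 r1 r2 tr two by simp
  qed
  have self: "s i i = 0" for i
  proof -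
    have "s i i = 2 * (a i * (1 - a i) - b i * z i)"
      by (simp add: s_def algebra_simps)
    then show ?thesis using two by simp
  qed
  have one: "s i j = 1" if "i < 4" "j < 4" "i \<noteq> j" for i j
    using off[OF that] by (simp add: s_def)
  have e: "k 1 + k 2 + k 3 + k 4 = 0" "k 0 + k 2 + k 3 + k 4 = 0"
       "k 0 + k 1 + k 3 + k 4 = 0" "k 0 + k 1 + k 2 + k 4 = 0"
    using pair[of 0] pair[of 1] pair[of 2] pair[of 3] by (simp_all add: self one)
  have eq: "k 1 = k 0" "k 2 = k 0" "k 3 = k 0" "k 4 = k 0"
  proof -
    have "k 1 - k 0 = (k 1 + k 2 + k 3 + k 4) - (k 0 + k 2 + k 3 + k 4)"
      "k 2 - k 0 = (k 1 + k 2 + k 3 + k 4) - (k 0 + k 1 + k 3 + k 4)"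
      "k 3 - k 0 = (k 1 + k 2 + k 3 + k 4) - (k 0 + k 1 + k 2 + k 4)"
      "k 4 - k 0 = (k 1 + k 2 + k 3 + k 4) - (k 0 + k 1 + k 2 + k 3)"
      by simp_all
    then show "k 1 = k 0" "k 2 = k 0" "k 3 = k 0" "k 4 = k 0"
      unfolding e tr by simp_all
  qed
  have k0: "k 0 \<noteq> 0" using nz eq by (auto simp: eval_nat_numeral less_Suc_eq)
  have a: "a 3 = 1 + a 0 + a 1 + a 2"
  proof -
    have "k 0 * (a 0 + a 1 + a 2 + a 3 + 1) = 0" using r0 eq by (simp add: algebra_simps)
    then have "a 3 = - (1 + a 0 + a 1 + a 2)" using k0 unfolding eq_neg_iff_add_eq_0 by (simp add: add_ac)
    then show ?thesis unfolding neg .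
  qed
  have b: "b 3 = b 0 + b 1 + b 2"
  proof -
    have "k 0 * (b 0 + b 1 + b 2 + b 3) = 0" using r1 eq by (simp add: algebra_simps)
    then have "b 3 = - (b 0 + b 1 + b 2)" using k0 unfolding eq_neg_iff_add_eq_0 by (simp add: add_ac)
    then show ?thesis unfolding neg .
  qed
  have z: "z 3 = z 0 + z 1 + z 2"
  proof -
    have "k 0 * (z 0 + z 1 + z 2 + z 3) = 0" using r2 eq by (simp add: algebra_simps)
    then have "z 3 = - (z 0 + z 1 + z 2)" using k0 unfolding eq_neg_iff_add_eq_0 by (simp add: add_ac)
    then show ?thesis unfolding neg .
  qed
  \<comment> \<open>Expansion of the determinant of a sum: three determinants and three polar forms,
    all equal to 1, and an even remainder.\<close>
  have "a 3 * (1 - a 3) - b 3 * z 3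
    = (a 0 * (1 - a 0) - b 0 * z 0) + (a 1 * (1 - a 1) - b 1 * z 1) + (a 2 * (1 - a 2) - b 2 * z 2)
      + s 0 1 + s 0 2 + s 1 2 - 2 * (2 * (a 0 + a 1 + a 2))"
    unfolding a b z s_def by (simp add: algebra_simps)
  also have "\<dots> = 6" unfolding two by (simp add: det one)
  also have "\<dots> = 2 * (3 :: 'a)" by simp
  also have "\<dots> = 0" by (simp only: two mult_zero_left)
  finally show False using det[of 3] by simp
qed

text \<open>Every entry \<open>1 - 2 * s\<close> is -1 or 3, so there are 64 patterns to evaluate.
  Up to sign the values are 16, 48, 80, 144, 432 and 1296, of which only 80 has a prime factor other
  than 2 and 3. It occurs only for patterns with an even number of signs -1 that are not all
  equal.\<close>

lemma gram_det_signs: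
  fixes s12 :: "'a::field"
  assumes three: "(3::'a) \<noteq> 0" and two: "(2::'a) \<noteq> 0"
    and sg: "s12 \<in> {1,-1}" "s13 \<in> {1,-1}" "s14 \<in> {1,-1}" "s23 \<in> {1,-1}" "s24 \<in> {1,-1}" "s34 \<in> {1,-1}"
    and D: "gram_det (1 - 2*s12) (1 - 2*s13) (1 - 2*s14) (1 - 2*s23) (1 - 2*s24) (1 - 2*s34) = 0"
  shows "(5::'a) = 0 \<and> s12*s13*s14*s23*s24*s34 = 1
      \<and> \<not> (s12 = s13 \<and> s12 = s14 \<and> s12 = s23 \<and> s12 = s24 \<and> s12 = s34)"
proof -
  have pow: "(2::'a) ^ n \<noteq> 0" "(3::'a) ^ n \<noteq> 0" for n
    using two three by auto
  have num: "(16::'a) = 2^4" "(48::'a) = 2^4 * 3" "(80::'a) = 2^4 * 5" "(144::'a) = 2^4 * 3^2"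
    "(432::'a) = 2^4 * 3^3" "(1296::'a) = 2^4 * 3^4"
    by simp_all
  have nz: "(16::'a) \<noteq> 0" "(48::'a) \<noteq> 0" "(144::'a) \<noteq> 0" "(432::'a) \<noteq> 0" "(1296::'a) \<noteq> 0"
    unfolding num mult_eq_0_iff using pow three by blast+
  have 80: "(80::'a) = 0 \<longleftrightarrow> (5::'a) = 0"
    unfolding num mult_eq_0_iff using pow by blast
  have m1: "(1::'a) \<noteq> - 1" using two by (metis add_eq_0_iff one_add_one)
  have t: "(1::'a) - 2 * 1 = - 1" "(1::'a) - 2 * - 1 = 3" by simp_all
  show ?thesis
    using sg D unfolding insert_iff empty_iff simp_thms
    by (elim disjE, simp_all only: t, simp_all add: gram_det_def nz 80 m1 two[symmetric])
qed

text \<open>The first conjunct bounds intersecting sets outside characteristic 5; the other two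
  restrict the signs in characteristic 5. Characteristic 2 is excluded first, since there 1 = -1
  makes all polar forms equal to 1.\<close>

lemma four_trace_1:
  fixes A :: "nat \<Rightarrow> 'a::field mat2"
  assumes three: "(3::'a) \<noteq> 0"
    and det: "\<And>i. i < 4 \<Longrightarrow> mat2_det (A i) = 1" and tr: "\<And>i. i < 4 \<Longrightarrow> mat2_tr (A i) = 1"
    and off: "\<And>i j. i < 4 \<Longrightarrow> j < 4 \<Longrightarrow> i \<noteq> j \<Longrightarrow> mat2_form (A i) (A j) \<in> {1,-1}"
  defines "s \<equiv> \<lambda>i j. mat2_form (A i) (A j)"
  shows "(5::'a) = 0 \<and> s 0 1 * s 0 2 * s 0 3 * s 1 2 * s 1 3 * s 2 3 = 1
      \<and> \<not> (s 0 1 = s 0 2 \<and> s 0 1 = s 0 3 \<and> s 0 1 = s 1 2 \<and> s 0 1 = s 1 3 \<and> s 0 1 = s 2 3)"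
proof -
  define a b z where "a i = fst (A i)" and "b i = fst (snd (A i))" and "z i = fst (snd (snd (A i)))" for i
  have A: "A i = (a i, b i, z i, 1 - a i)" if "i < 4" for i
    using tr[OF that] by (cases "A i") (auto simp: mat2_tr_def a_def b_def z_def algebra_simps)
  have d: "a i * (1 - a i) - b i * z i = 1" if "i < 4" for i
    using det[OF that] A[OF that] by (simp add: mat2_det_def)
  have s: "s i j = a i + a j - 2 * a i * a j - b i * z j - z i * b j" if "i < 4" "j < 4" for i j
    using A that by (simp add: s_def mat2_form_def algebra_simps)
  have sg: "s i j \<in> {1,-1}" if "i < 4" "j < 4" "i \<noteq> j" for i j
    using off[OF that] by (simp add: s_def)
  have two: "(2::'a) \<noteq> 0"
  proof
    assume two: "(2::'a) = 0"
    then have "(- 1 :: 'a) = 1" by (metis add_eq_0_iff2 one_add_one)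
    then have "s i j = 1" if "i < 4" "j < 4" "i \<noteq> j" for i j using sg[OF that] by auto
    then have one: "a i + a j - 2 * a i * a j - b i * z j - z i * b j = 1"
      if "i < 4" "j < 4" "i \<noteq> j" for i j
      using s[of i j] that by simp
    show False by (rule no_four_trace_1_char_2[OF two d one])
  qed
  show ?thesis
  proof (rule gram_det_signs[OF three two])
    show "gram_det (1 - 2 * s 0 1) (1 - 2 * s 0 2) (1 - 2 * s 0 3)
        (1 - 2 * s 1 2) (1 - 2 * s 1 3) (1 - 2 * s 2 3) = 0"
      using gram_det_eq_0[OF d]
      by (simp only: s zero_less_numeral one_less_numeral_iff numeral_less_iff semiring_norm)
  qed (intro sg; simp)+
qed

text \<open>View the indices as vertices of a complete graph with signed edges. The parity condition
  on all quadruples forces the edges at each vertex to have equal sign, hence all edges, against the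
  last conjunct of \<open>four_trace_1\<close>.\<close>

lemma no_six_trace_1:
  fixes A :: "nat \<Rightarrow> 'a::field mat2"
  assumes three: "(3::'a) \<noteq> 0"
    and det: "\<And>i. i < 6 \<Longrightarrow> mat2_det (A i) = 1" and tr: "\<And>i. i < 6 \<Longrightarrow> mat2_tr (A i) = 1"
    and off: "\<And>i j. i < 6 \<Longrightarrow> j < 6 \<Longrightarrow> i \<noteq> j \<Longrightarrow> mat2_form (A i) (A j) \<in> {1,-1}"
  shows False
proof -
  define s where "s i j = mat2_form (A i) (A j)" for i j
  have sym: "s i j = s j i" for i j by (simp add: s_def mat2_form_sym)
  have sq: "s i j * s i j = 1" if "i < 6" "j < 6" "i \<noteq> j" for i j
    using off[OF that] by (auto simp: s_def)
  have four: "s i j * s i k * s i l * s j k * s j l * s k l = 1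
      \<and> \<not> (s i j = s i k \<and> s i j = s i l \<and> s i j = s j k \<and> s i j = s j l \<and> s i j = s k l)"
    if "distinct [i,j,k,l]" "set [i,j,k,l] \<subseteq> {..<6}" for i j k l
  proof -
    have "[i,j,k,l] ! m \<in> {..<6}" if "m < 4" for m
      using \<open>set [i,j,k,l] \<subseteq> {..<6}\<close> nth_mem[of m "[i,j,k,l]"] that by auto
    moreover have "[i,j,k,l] ! m \<noteq> [i,j,k,l] ! n" if "m < 4" "n < 4" "m \<noteq> n" for m n
      using \<open>distinct [i,j,k,l]\<close> nth_eq_iff_index_eq[of "[i,j,k,l]" m n] that by auto
    ultimately show ?thesis
      using four_trace_1[OF three, of "\<lambda>m. A ([i,j,k,l] ! m)"] det tr off
      by (simp add: s_def numeral_2_eq_2 numeral_3_eq_3)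
  qed
  \<comment> \<open>Multiply the parity conditions of the four quadruples formed by \<open>v\<close>
    and three of the others: edges at \<open>v\<close> occur three times, the remaining edges
    twice.\<close>
  have star: "s v i * s v j * s v k * s v l = 1"
    if d: "distinct [v,i,j,k,l]" "set [v,i,j,k,l] \<subseteq> {..<6}" for v i j k l
  proof -
    have "s v i * s v j * s v k * s v l
        = (s v i * s v j * s v k * s i j * s i k * s j k) * (s v i * s v j * s v l * s i j * s i l * s j l)
        * (s v i * s v k * s v l * s i k * s i l * s k l) * (s v j * s v k * s v l * s j k * s j l * s k l)" (is "?L = ?R")
    proof -
      have "?R = ?L * ((s v i * s v i) * (s v j * s v j) * (s v k * s v k) * (s v l * s v l)
          * (s i j * s i j) * (s i k * s i k) * (s i l * s i l)
          * (s j k * s j k) * (s j l * s j l) * (s k l * s k l))"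
        by (simp only: ac_simps)
      also have "\<dots> = ?L" using sq d by simp
      finally show ?thesis ..
    qed
    also have "\<dots> = 1"
      using four[of v i j k] four[of v i j l] four[of v i k l] four[of v j k l] d by simp
    finally show ?thesis .
  qed
  \<comment> \<open>Compare two stars at \<open>v\<close> that share three edges; this takes six
    vertices.\<close>
  have const: "s v k = s v l"
    if d: "distinct [v,i,j,m,k,l]" "set [v,i,j,m,k,l] \<subseteq> {..<6}" for v i j m k l
  proof -
    have "s v i * s v j * s v m * s v k = s v i * s v j * s v m * s v l"
      using star[of v i j m k] star[of v i j m l] d by simp
    moreover have "s v i * s v j * s v m \<noteq> 0"
      using sq[of v i] sq[of v j] sq[of v m] d by auto
    ultimately show ?thesis by simp
  qed
  have "s 0 1 = s 0 2" "s 0 2 = s 0 3" "s 1 0 = s 1 2" "s 1 2 = s 1 3" "s 2 1 = s 2 3"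
    using const[of 0 3 4 5 1 2] const[of 0 1 4 5 2 3] const[of 1 3 4 5 0 2] const[of 1 0 4 5 2 3]
      const[of 2 0 4 5 1 3] by auto
  then show False
    using four[of 0 1 2 3] sym[of 0 1] sym[of 1 2] by auto
qed

section \<open>Actions on cosets of a subgroup of order three\<close>

lemma (in group) conj_cancel:
  assumes "a \<in> carrier G" "x \<in> carrier G"
  shows "inv a \<otimes> (a \<otimes> x \<otimes> inv a) \<otimes> a = x" "a \<otimes> (inv a \<otimes> x \<otimes> a) \<otimes> inv a = x"
proof -
  have "inv a \<otimes> (a \<otimes> y) = y" "a \<otimes> (inv a \<otimes> y) = y" if "y \<in> carrier G" for y
    using assms that by (simp_all add: m_assoc[symmetric])
  then show "inv a \<otimes> (a \<otimes> x \<otimes> inv a) \<otimes> a = x" "a \<otimes> (inv a \<otimes> x \<otimes> a) \<otimes> inv a = x"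
    using assms by (simp_all add: m_assoc)
qed

lemma (in group) subgroup_card_3_cube:
  assumes sub: "subgroup H G" and card3: "card H = 3" and x: "x \<in> H"
  shows "x [^] (3::nat) = \<one>"
proof -
  interpret K: group "G\<lparr>carrier := H\<rparr>" by (rule subgroup.subgroup_is_group[OF sub is_group])
  have "x [^]\<^bsub>G\<lparr>carrier := H\<rparr>\<^esub> order (G\<lparr>carrier := H\<rparr>) = \<one>\<^bsub>G\<lparr>carrier := H\<rparr>\<^esub>"
    using K.pow_order_eq_1 x by simp
  then show ?thesis by (simp add: order_def card3 nat_pow_consistent[symmetric])
qed

lemma (in group) translated_coset_eq_iff:
  assumes "subgroup H G" "a \<in> carrier G" "g \<in> carrier G" "h \<in> carrier G"
  shows "g <# (a <# H) = h <# (a <# H) \<longleftrightarrow> inv a \<otimes> (inv g \<otimes> h) \<otimes> a \<in> H"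
proof -
  interpret H: subgroup H G by fact
  have HG: "H \<subseteq> carrier G" by (rule H.subset)
  have eq: "inv a \<otimes> (inv g \<otimes> h) \<otimes> a = inv (g \<otimes> a) \<otimes> (h \<otimes> a)"
    using assms by (simp add: inv_mult_group m_assoc)
  have "(g \<otimes> a) <# H = (h \<otimes> a) <# H \<longleftrightarrow> inv (g \<otimes> a) \<otimes> (h \<otimes> a) \<in> H"
  proof
    assume "(g \<otimes> a) <# H = (h \<otimes> a) <# H"
    then have "h \<otimes> a \<in> (g \<otimes> a) <# H"
      using lcos_self[of "h \<otimes> a" H] assms by simp
    then show "inv (g \<otimes> a) \<otimes> (h \<otimes> a) \<in> H"
      using H.lcos_module_imp[OF is_group, of "g \<otimes> a" "h \<otimes> a"] assms by simp
  next
    assume "inv (g \<otimes> a) \<otimes> (h \<otimes> a) \<in> H"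
    then have "h \<otimes> a \<in> (g \<otimes> a) <# H"
      using H.lcos_module_rev[OF is_group, of "g \<otimes> a" "h \<otimes> a"] assms by simp
    then show "(g \<otimes> a) <# H = (h \<otimes> a) <# H"
      using l_repr_independence[of "h \<otimes> a" "g \<otimes> a" H] assms by simp
  qed
  then show ?thesis using assms HG eq by (simp add: lcos_m_assoc)
qed

text \<open>When every element with trivial cube is conjugate into \<open>H\<close>, two group elements agree on a
  coset of \<open>H\<close> exactly when their quotient has trivial cube.\<close>
locale conjugate_cube_roots = group +
  fixes H
  assumes sub: "subgroup H G" and card3: "card H = 3"
    and conj: "\<And>x. x \<in> carrier G \<Longrightarrow> x [^] (3::nat) = \<one> \<Longrightarrow> \<exists>a\<in>carrier G. inv a \<otimes> x \<otimes> a \<in> H"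
    and many: "card {x \<in> carrier G. x [^] (3::nat) = \<one>} > 3"
begin

lemma H_carrier: "x \<in> H \<Longrightarrow> x \<in> carrier G"
  using sub subgroup.mem_carrier by metis

lemma conj_pow:
  assumes "a \<in> carrier G" "x \<in> carrier G"
  shows "(inv a \<otimes> x \<otimes> a) [^] (3::nat) = inv a \<otimes> x [^] (3::nat) \<otimes> a"
proof -
  have "a \<otimes> (inv a \<otimes> y) = y" if "y \<in> carrier G" for y
    using assms that by (simp add: m_assoc[symmetric])
  then show ?thesis
    using assms by (simp add: numeral_3_eq_3 m_assoc)
qed

lemma agree_iff:
  assumes "g \<in> carrier G" "h \<in> carrier G"
  shows "(\<exists>v\<in>coset_space G H. coset_action G H g v = coset_action G H h v)
    \<longleftrightarrow> (inv g \<otimes> h) [^] (3::nat) = \<one>"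
proof -
  have "(\<exists>v\<in>coset_space G H. coset_action G H g v = coset_action G H h v)
      \<longleftrightarrow> (\<exists>a\<in>carrier G. g <# (a <# H) = h <# (a <# H))"
    by (auto simp: coset_space_def coset_action_def)
  also have "\<dots> \<longleftrightarrow> (\<exists>a\<in>carrier G. inv a \<otimes> (inv g \<otimes> h) \<otimes> a \<in> H)"
    using translated_coset_eq_iff[OF sub] assms by auto
  also have "\<dots> \<longleftrightarrow> (inv g \<otimes> h) [^] (3::nat) = \<one>"
  proof
    assume "\<exists>a\<in>carrier G. inv a \<otimes> (inv g \<otimes> h) \<otimes> a \<in> H"
    then obtain a where a: "a \<in> carrier G" "inv a \<otimes> (inv g \<otimes> h) \<otimes> a \<in> H" by blast
    let ?k = "(inv g \<otimes> h) [^] (3::nat)"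
    have k: "?k \<in> carrier G" using assms by simp
    have "inv a \<otimes> ?k \<otimes> a = \<one>"
      using subgroup_card_3_cube[OF sub card3 a(2)] conj_pow[OF a(1), of "inv g \<otimes> h"] assms by simp
    then show "?k = \<one>" using conj_cancel(2)[OF a(1) k] a(1) by simp
  next
    assume "(inv g \<otimes> h) [^] (3::nat) = \<one>"
    then show "\<exists>a\<in>carrier G. inv a \<otimes> (inv g \<otimes> h) \<otimes> a \<in> H" using conj assms by simp
  qed
  finally show ?thesis .
qed

text \<open>Faithfulness lets cardinalities pass between group elements and permutations. If
  \<open>g\<close> and \<open>h\<close> acted alike, all conjugates of their quotient
  \<open>k\<close> would lie in \<open>H\<close>. As \<open>k\<close> generates \<open>H\<close>,
  the subgroup would be normal and contain every element with trivial cube, against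
  \<open>many\<close>.\<close>

lemma inj_action: "inj_on (coset_action G H) (carrier G)"
proof (rule inj_onI, rule ccontr)
  fix g h assume gh: "g \<in> carrier G" "h \<in> carrier G" "g \<noteq> h"
    and eq: "coset_action G H g = coset_action G H h"
  define k where "k = inv g \<otimes> h"
  have kG: "k \<in> carrier G" using gh by (simp add: k_def)
  have k1: "k \<noteq> \<one>" using gh by (metis k_def inv_equality inv_inv inv_closed)
  have kH: "inv a \<otimes> k \<otimes> a \<in> H" if a: "a \<in> carrier G" for a
  proof -
    have "a <# H \<in> coset_space G H" using a by (auto simp: coset_space_def)
    then have "g <# (a <# H) = h <# (a <# H)"
      using fun_cong[OF eq, of "a <# H"] by (simp add: coset_action_def)
    then show ?thesis using translated_coset_eq_iff[OF sub a gh(1,2)] by (simp add: k_def)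
  qed
  have "k \<in> H" using kH[of \<one>] kG by simp
  have k3: "k \<otimes> k \<otimes> k = \<one>" using subgroup_card_3_cube[OF sub card3 \<open>k \<in> H\<close>] kG by (simp add: numeral_3_eq_3)
  have "inv k \<noteq> k"
  proof
    assume "inv k = k"
    then have "k \<otimes> k = \<one>" using kG by (metis r_inv)
    then show False using k3 k1 kG by simp
  qed
  have invk: "inv k \<in> H" using \<open>k \<in> H\<close> sub by (simp add: subgroup.m_inv_closed)
  have finH: "finite H" using card3 card.infinite by fastforce
  have ik1: "inv k \<noteq> \<one>" using k1 kG by simp
  have "card {\<one>, k, inv k} = 3" using k1 ik1 \<open>inv k \<noteq> k\<close> by simp
  moreover have "{\<one>, k, inv k} \<subseteq> H"
    using \<open>k \<in> H\<close> invk sub subgroup.one_closed by auto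
  ultimately have H: "H = {\<one>, k, inv k}" using card3 finH card_subset_eq by metis
  have "{x \<in> carrier G. x [^] (3::nat) = \<one>} \<subseteq> H"
  proof safe
    fix x assume x: "x \<in> carrier G" "x [^] (3::nat) = \<one>"
    then obtain a where a: "a \<in> carrier G" "inv a \<otimes> x \<otimes> a \<in> H" using conj by blast
    define c where "c y = inv a \<otimes> y \<otimes> a" for y
    have inj: "inj_on c (carrier G)" using a by (auto simp: inj_on_def c_def)
    have "c \<one> \<in> H" using a H by (simp add: c_def)
    moreover have "c k \<in> H" using kH a by (simp add: c_def)
    moreover have "c (inv k) = inv (c k)" using a kG by (simp add: c_def inv_mult_group m_assoc)
    ultimately have "c ` {\<one>, k, inv k} \<subseteq> H" using subgroup.m_inv_closed[OF sub] by simp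
    then have "c ` H \<subseteq> H" unfolding H[symmetric] .
    \<comment> \<open>Conjugation by \<open>a\<close> is injective on the finite set
      \<open>H\<close>, hence onto it, so \<open>x\<close> lies in \<open>H\<close> because its
      conjugate does.\<close>
    then have "c ` H = H"
      using inj finH H_carrier by (meson endo_inj_surj inj_on_subset subsetI)
    then obtain y where "y \<in> H" "c x = c y" using a(2) by (force simp: c_def)
    then show "x \<in> H" using inj x H_carrier by (metis inj_onD)
  qed
  then show False using many card_mono[OF finH, of "{x \<in> carrier G. x [^] (3::nat) = \<one>}"] card3 by linarith
qed

text \<open>The stabilizer of the coset aH is the image of the conjugate of \<open>H\<close> by
  \<open>a\<close>, and the action is faithful.\<close>

lemma card_stabilizer:
  assumes "v \<in> coset_space G H"
  shows "card (point_stabilizer (coset_perm_group G H) v) = 3"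
proof -
  obtain a where a: "a \<in> carrier G" "v = a <# H" using assms by (auto simp: coset_space_def)
  have iff: "coset_action G H g v = v \<longleftrightarrow> inv a \<otimes> g \<otimes> a \<in> H" if g: "g \<in> carrier G" for g
  proof -
    have "\<one> <# v = v" using a sub by (simp add: lcos_mult_one l_coset_subset_G subgroup.subset)
    then have "coset_action G H g v = v \<longleftrightarrow> \<one> <# (a <# H) = g <# (a <# H)"
      using assms a by (auto simp: coset_action_def)
    then show ?thesis using translated_coset_eq_iff[OF sub a(1) one_closed g] g by simp
  qed
  have "point_stabilizer (coset_perm_group G H) v
      = coset_action G H ` {g \<in> carrier G. inv a \<otimes> g \<otimes> a \<in> H}"
    using iff by (auto simp: point_stabilizer_def coset_perm_group_def)
  moreover have "bij_betw (\<lambda>x. a \<otimes> x \<otimes> inv a) H {g \<in> carrier G. inv a \<otimes> g \<otimes> a \<in> H}"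
    by (rule bij_betw_byWitness[where f' = "\<lambda>g. inv a \<otimes> g \<otimes> a"])
       (use a conj_cancel H_carrier in auto)
  ultimately show ?thesis
    using card3 bij_betw_same_card card_image inj_on_subset[OF inj_action]
    by (metis (no_types, lifting) mem_Collect_eq subsetI)
qed

text \<open>Reduces the density to a question inside the group: by \<open>agree_iff\<close>
  intersecting sets are those whose quotients have trivial cube, and every stabilizer has three
  elements.\<close>

lemma intersection_density_eq:
  assumes bound: "\<And>S. S \<subseteq> carrier G \<Longrightarrow> (\<And>g h. g \<in> S \<Longrightarrow> h \<in> S \<Longrightarrow> (inv g \<otimes> h) [^] (3::nat) = \<one>)
      \<Longrightarrow> card S \<le> m"
    and attained: "S \<subseteq> carrier G" "\<And>g h. g \<in> S \<Longrightarrow> h \<in> S \<Longrightarrow> (inv g \<otimes> h) [^] (3::nat) = \<one>" "card S = m"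
  shows "intersection_density (coset_space G H) (coset_perm_group G H) = m / 3"
proof -
  have int_iff: "intersecting_set (coset_space G H) (coset_action G H ` S)
      \<longleftrightarrow> (\<forall>g\<in>S. \<forall>h\<in>S. (inv g \<otimes> h) [^] (3::nat) = \<one>)" if "S \<subseteq> carrier G" for S
    unfolding intersecting_set_def ball_simps using agree_iff that by (simp add: subset_eq)
  have card: "card (coset_action G H ` S) = card S" if "S \<subseteq> carrier G" for S
    using inj_on_subset[OF inj_action that] by (rule card_image)
  let ?C = "{card F | F. F \<subseteq> coset_perm_group G H \<and> intersecting_set (coset_space G H) F}"
  have le: "x \<le> m" if x: "x \<in> ?C" for x
  proof -
    obtain F where F: "x = card F" "F \<subseteq> coset_perm_group G H" "intersecting_set (coset_space G H) F"
      using x by blast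
    then obtain T where T: "T \<subseteq> carrier G" "F = coset_action G H ` T"
      unfolding coset_perm_group_def by (auto elim: subset_imageE)
    then show ?thesis using F card[OF T(1)] int_iff[OF T(1)] bound[OF T(1)] by simp
  qed
  have mem: "m \<in> ?C"
    using attained int_iff[OF attained(1)] card[OF attained(1)]
    by (intro CollectI exI[of _ "coset_action G H ` S"]) (auto simp: coset_perm_group_def)
  have "finite ?C" using le by (meson finite_nat_set_iff_bounded_le)
  then have max: "Max ?C = m" using le mem by (intro Max_eqI) auto
  have stab: "{card (point_stabilizer (coset_perm_group G H) v) | v. v \<in> coset_space G H} = {3}"
  proof -
    have "\<one> <# H \<in> coset_space G H" by (auto simp: coset_space_def)
    then have "(\<lambda>v. card (point_stabilizer (coset_perm_group G H) v)) ` coset_space G H = {3}"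
      using card_stabilizer by force
    then show ?thesis by (simp only: setcompr_eq_image Collect_mem_eq)
  qed
  show ?thesis unfolding intersection_density_def max stab by simp
qed

end

section \<open>Sixth roots of unity in finite fields\<close>

text \<open>Without a fixed point, the orbits of \<open>f\<close> would partition \<open>A\<close>
  into triples.\<close>

lemma fixed_point_of_order_3:
  assumes fin: "finite A" and f: "\<And>x. x \<in> A \<Longrightarrow> f x \<in> A" "\<And>x. x \<in> A \<Longrightarrow> f (f (f x)) = x"
    and card: "\<not> 3 dvd card A"
  shows "\<exists>x\<in>A. f x = x"
proof (rule ccontr)
  assume no: "\<not> (\<exists>x\<in>A. f x = x)"
  let ?orb = "\<lambda>x. {x, f x, f (f x)}"
  have "3 dvd card (\<Union>(?orb ` A))"
  proof (rule dvd_partition)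
    have "\<Union>(?orb ` A) = A" using f by auto
    then show "finite (\<Union>(?orb ` A))" using fin by simp
    show "\<forall>c\<in>?orb ` A. 3 dvd card c"
    proof
      fix c assume "c \<in> ?orb ` A"
      then obtain x where x: "x \<in> A" "c = ?orb x" by blast
      have "f x \<noteq> x" "f (f x) \<noteq> f x" "f (f x) \<noteq> x"
        using no f x by metis+
      then have "card c = 3" using x by simp
      then show "3 dvd card c" by simp
    qed
    have orb: "?orb z = ?orb x" if "x \<in> A" "z \<in> ?orb x" for x z
      using that f by auto
    show "\<forall>c1\<in>?orb ` A. \<forall>c2\<in>?orb ` A. c1 \<noteq> c2 \<longrightarrow> c1 \<inter> c2 = {}"
    proof (intro ballI impI, rule ccontr)
      fix c1 c2 assume c: "c1 \<in> ?orb ` A" "c2 \<in> ?orb ` A" "c1 \<noteq> c2" "c1 \<inter> c2 \<noteq> {}"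
      then obtain x y where xy: "x \<in> A" "c1 = ?orb x" "y \<in> A" "c2 = ?orb y" by blast
      obtain z where "z \<in> c1" "z \<in> c2" using c(4) by blast
      then show False using orb[of x z] orb[of y z] xy c(3) by simp
    qed
  qed
  moreover have "\<Union>(?orb ` A) = A" using f by auto
  ultimately show False using card by simp
qed

text \<open>The map \<open>x \<mapsto> 1 / (1 - x)\<close> has order three on the field without 0 and 1; its fixed points are
  the primitive sixth roots of unity.\<close>
lemma primitive_sixth_root_exists:
  assumes fin: "finite (UNIV :: 'a::field set)" and card: "card (UNIV :: 'a set) mod 3 = 1"
  shows "\<exists>\<zeta>::'a. \<zeta> * (1 - \<zeta>) = 1"
proof -
  let ?f = "\<lambda>x::'a. 1 / (1 - x)"
  have "card (UNIV - {0, 1 :: 'a}) = card (UNIV :: 'a set) - 2"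
    using fin by (simp add: card_Diff_subset)
  moreover have "card (UNIV :: 'a set) \<ge> card {0, 1 :: 'a}"
    using fin by (intro card_mono) auto
  ultimately have "card (UNIV - {0, 1 :: 'a}) + 2 = card (UNIV :: 'a set)" by simp
  \<comment> \<open>If q is 1 modulo 3, then q - 2 is 2 modulo 3.\<close>
  then have "\<not> 3 dvd card (UNIV - {0, 1 :: 'a})" using card by presburger
  then have "\<exists>x\<in>UNIV - {0, 1 :: 'a}. ?f x = x"
  proof (rule fixed_point_of_order_3[rotated 3])
    show "finite (UNIV - {0, 1 :: 'a})" using fin by simp
    show "?f x \<in> UNIV - {0, 1}" if "x \<in> UNIV - {0, 1}" for x
      using that by (auto simp: field_simps)
    show "?f (?f (?f x)) = x" if "x \<in> UNIV - {0, 1}" for x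
    proof -
      have "1 - ?f x = - x / (1 - x)" using that by (simp add: field_simps)
      then have "?f (?f x) = 1 - 1 / x" using that by (simp add: field_simps)
      then show ?thesis by simp
    qed
  qed
  then obtain x :: 'a where "x \<noteq> 1" "1 / (1 - x) = x" by blast
  then have "x * (1 - x) = 1" by (simp add: field_simps)
  then show ?thesis ..
qed

section \<open>Elements of order three in PSL(2,q)\<close>

lemma SL2_simps [simp]:
  "carrier SL2 = {A. mat2_det A = 1}" "monoid.mult SL2 = mat2_mult" "one SL2 = (1,0,0,1)"
  by (simp_all add: SL2_def)

lemma SL2_group: "group (SL2 :: 'a::field mat2 monoid)"
proof (rule groupI)
  fix A :: "'a mat2" assume A: "A \<in> carrier SL2"
  obtain a b c d where [simp]: "A = (a,b,c,d)" by (cases A)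
  show "\<exists>B\<in>carrier SL2. B \<otimes>\<^bsub>SL2\<^esub> A = \<one>\<^bsub>SL2\<^esub>"
    using A by (intro bexI[of _ "(d,-b,-c,a)"]) (auto simp: mat2_det_def mat2_mult_def algebra_simps)
  show "\<one>\<^bsub>SL2\<^esub> \<otimes>\<^bsub>SL2\<^esub> A = A" by (simp add: mat2_mult_def)
next
  fix A B :: "'a mat2" assume AB: "A \<in> carrier SL2" "B \<in> carrier SL2"
  have "mat2_det (mat2_mult A B) = mat2_det A * mat2_det B"
    by (cases A; cases B) (simp add: mat2_det_def mat2_mult_def algebra_simps)
  then show "A \<otimes>\<^bsub>SL2\<^esub> B \<in> carrier SL2" using AB by simp
next
  fix A B C :: "'a mat2"
  show "A \<otimes>\<^bsub>SL2\<^esub> B \<otimes>\<^bsub>SL2\<^esub> C = A \<otimes>\<^bsub>SL2\<^esub> (B \<otimes>\<^bsub>SL2\<^esub> C)"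
    by (cases A; cases B; cases C) (simp add: mat2_mult_def algebra_simps)
qed (simp add: mat2_det_def)

lemma SL2_inv:
  assumes "mat2_det (a,b,c,d) = (1::'a::field)"
  shows "inv\<^bsub>SL2\<^esub> (a,b,c,d) = (d,-b,-c,a)"
  by (rule group.inv_equality[OF SL2_group])
     (use assms in \<open>auto simp: mat2_det_def mat2_mult_def algebra_simps\<close>)

lemma SL2_center_normal: "normal {(1,0,0,1), (-1,0,0,-1)} (SL2 :: 'a::field mat2 monoid)"
proof -
  interpret group "SL2 :: 'a mat2 monoid" by (rule SL2_group)
  have inv1: "inv\<^bsub>SL2\<^esub> (- 1,0,0,- 1) = (- 1,0,0,- 1 :: 'a)"
    by (subst SL2_inv) (simp_all add: mat2_det_def)
  have "subgroup {(1,0,0,1), (-1,0,0,-1)} (SL2 :: 'a mat2 monoid)"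
    using inv1 inv_one by (intro subgroupI) (auto simp: mat2_det_def mat2_mult_def)
  moreover have "x \<otimes>\<^bsub>SL2\<^esub> h \<otimes>\<^bsub>SL2\<^esub> inv\<^bsub>SL2\<^esub> x \<in> {(1,0,0,1), (-1,0,0,-1)}"
    if x: "x \<in> carrier SL2" and h: "h \<in> {(1,0,0,1), (-1,0,0,-1)}" for x h :: "'a mat2"
  proof -
    obtain a b c d where abcd: "x = (a,b,c,d)" by (cases x)
    with x h show ?thesis
      by (auto simp: SL2_inv) (auto simp: mat2_mult_def mat2_det_def algebra_simps)
  qed
  ultimately show ?thesis unfolding normal_inv_iff by blast
qed

text \<open>The quotient map, in the right coset form of the elements of \<open>Mod\<close>. The
  value at A consists of A and -A, which coincide in characteristic 2.\<close>

definition psl2 :: "'a::field mat2 \<Rightarrow> 'a mat2 set" where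
  "psl2 A = {(1,0,0,1), (-1,0,0,-1)} #>\<^bsub>SL2\<^esub> A"

lemma psl2_eq: "psl2 (a,b,c,d) = {(a,b,c,d), (-a,-b,-c,-d)}"
  by (auto simp: psl2_def r_coset_def mat2_mult_def)

lemma psl2_hom: "group_hom SL2 PSL2 (psl2 :: 'a::field mat2 \<Rightarrow> _)"
proof -
  interpret N: normal "{(1,0,0,1), (-1,0,0,-1)}" "SL2 :: 'a mat2 monoid" by (rule SL2_center_normal)
  show ?thesis
    unfolding group_hom_def group_hom_axioms_def PSL2_def
    using N.factorgroup_is_group N.r_coset_hom_Mod SL2_group
    by (simp add: psl2_def[abs_def])
qed

lemma PSL2_carrier: "carrier PSL2 = psl2 ` (carrier SL2 :: 'a::field mat2 set)"
  by (simp add: PSL2_def carrier_FactGroup psl2_def)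

lemma psl2_eq_one_iff: "psl2 A = \<one>\<^bsub>PSL2\<^esub> \<longleftrightarrow> A \<in> {(1,0,0,1), (-1,0,0,-1)}"
  by (cases A) (auto simp: psl2_eq PSL2_def doubleton_eq_iff)

text \<open>By Cayley-Hamilton, A^2 = t A - 1 for determinant 1 and trace t, hence A^3 = (t^2 - 1) A
  - t.\<close>

lemma SL2_cube:
  fixes a b c d :: "'a::field"
  assumes "mat2_det (a,b,c,d) = 1" and t: "t = a + d"
  shows "(a,b,c,d) [^]\<^bsub>SL2\<^esub> (3::nat)
    = ((t^2 - 1) * a - t, (t^2 - 1) * b, (t^2 - 1) * c, (t^2 - 1) * d - t)"
proof -
  have bc: "b * c = a * d - 1" using assms by (simp add: mat2_det_def algebra_simps)
  have bc': "b * (c * x) = (a * d - 1) * x" for x using bc by (simp flip: mult.assoc)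
  show ?thesis
    by (simp add: numeral_3_eq_3 mat2_mult_def t power2_eq_square algebra_simps bc bc')
qed

text \<open>If t^2 = 1, then A^3 = (t^2 - 1) A - t is the scalar -t, that is 1 or -1. Otherwise a
  scalar cube forces A to be scalar, and determinant 1 leaves only 1 and -1.\<close>

lemma psl2_cube_iff:
  assumes A: "A \<in> carrier (SL2 :: 'a::field mat2 monoid)"
  shows "psl2 A [^]\<^bsub>PSL2\<^esub> (3::nat) = \<one>\<^bsub>PSL2\<^esub>
    \<longleftrightarrow> A \<in> {(1,0,0,1), (-1,0,0,-1)} \<or> mat2_tr A \<in> {1,-1}"
proof -
  interpret psl2: group_hom SL2 PSL2 "psl2 :: 'a mat2 \<Rightarrow> _" by (rule psl2_hom)
  obtain a b c d where abcd: "A = (a,b,c,d)" by (cases A)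
  define t where "t = a + d"
  have det: "a * d - b * c = 1" using A abcd by (simp add: mat2_det_def)
  have "psl2 A [^]\<^bsub>PSL2\<^esub> (3::nat) = psl2 (A [^]\<^bsub>SL2\<^esub> (3::nat))"
    using psl2.hom_nat_pow[OF A] by simp
  also have "\<dots> = \<one>\<^bsub>PSL2\<^esub> \<longleftrightarrow>
      ((t^2 - 1) * a - t, (t^2 - 1) * b, (t^2 - 1) * c, (t^2 - 1) * d - t) \<in> {(1,0,0,1), (-1,0,0,-1)}"
    unfolding psl2_eq_one_iff abcd using SL2_cube[of a b c d t] det by (simp add: mat2_det_def t_def)
  also have "\<dots> \<longleftrightarrow> A \<in> {(1,0,0,1), (-1,0,0,-1)} \<or> t \<in> {1,-1}"
  proof (cases "t^2 = 1")
    case True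
    then have "t = 1 \<or> t = - 1" by (simp add: power2_eq_1_iff)
    then show ?thesis by auto
  next
    case False
    then have t: "t \<noteq> 1" "t \<noteq> - 1" by auto
    show ?thesis
    proof
      assume cube: "((t^2 - 1) * a - t, (t^2 - 1) * b, (t^2 - 1) * c, (t^2 - 1) * d - t)
          \<in> {(1,0,0,1), (-1,0,0,-1)}"
      then obtain e where e: "(t^2 - 1) * a - t = e" "(t^2 - 1) * d - t = e"
          "(t^2 - 1) * b = 0" "(t^2 - 1) * c = 0"
        by blast
      have bc: "b = 0" "c = 0" using e(3,4) False by simp_all
      have "d = a" using trans[OF e(2) e(1)[symmetric]] False by simp
      then have "a^2 = 1" using det bc by (simp add: power2_eq_square)
      then have "a = 1 \<or> a = - 1" by (simp add: power2_eq_1_iff)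
      then show "A \<in> {(1,0,0,1), (-1,0,0,-1)} \<or> t \<in> {1,-1}" using abcd bc \<open>d = a\<close> by auto
    next
      assume "A \<in> {(1,0,0,1), (-1,0,0,-1)} \<or> t \<in> {1,-1}"
      then have "A \<in> {(1,0,0,1), (-1,0,0,-1)}" using t by blast
      then show "((t^2 - 1) * a - t, (t^2 - 1) * b, (t^2 - 1) * c, (t^2 - 1) * d - t)
          \<in> {(1,0,0,1), (-1,0,0,-1)}"
        by (auto simp: abcd t_def)
    qed
  qed
  finally show ?thesis by (simp add: mat2_tr_def abcd t_def)
qed

section \<open>Quotients in PSL(2,q) and the polar form\<close>

lemma psl2_quotient:
  assumes "A \<in> carrier (SL2 :: 'a::field mat2 monoid)" "B \<in> carrier SL2"
  shows "inv\<^bsub>PSL2\<^esub> psl2 A \<otimes>\<^bsub>PSL2\<^esub> psl2 B = psl2 (inv\<^bsub>SL2\<^esub> A \<otimes>\<^bsub>SL2\<^esub> B)"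
proof -
  interpret psl2: group_hom SL2 PSL2 "psl2 :: 'a mat2 \<Rightarrow> _" by (rule psl2_hom)
  show ?thesis using assms psl2.hom_inv psl2.hom_mult psl2.G.inv_closed by metis
qed

lemma mat2_form_eq_tr:
  assumes "A \<in> carrier (SL2 :: 'a::field mat2 monoid)"
  shows "mat2_tr (inv\<^bsub>SL2\<^esub> A \<otimes>\<^bsub>SL2\<^esub> B) = mat2_form A B"
  using assms by (cases A; cases B) (simp add: SL2_inv mat2_tr_def mat2_form_def mat2_mult_def)

text \<open>The passage from group theory to the quadratic space: \<open>psl2_cube_iff\<close> is
  applied to the quotient of A and B, whose trace is the polar form.\<close>

lemma psl2_quotient_cube_iff:
  assumes "A \<in> carrier (SL2 :: 'a::field mat2 monoid)" "B \<in> carrier SL2"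
  shows "(inv\<^bsub>PSL2\<^esub> psl2 A \<otimes>\<^bsub>PSL2\<^esub> psl2 B) [^]\<^bsub>PSL2\<^esub> (3::nat) = \<one>\<^bsub>PSL2\<^esub>
    \<longleftrightarrow> psl2 A = psl2 B \<or> mat2_form A B \<in> {1,-1}"
proof -
  interpret psl2: group_hom SL2 PSL2 "psl2 :: 'a mat2 \<Rightarrow> _" by (rule psl2_hom)
  let ?Q = "inv\<^bsub>SL2\<^esub> A \<otimes>\<^bsub>SL2\<^esub> B"
  have Q: "?Q \<in> carrier SL2" using assms by (intro psl2.G.m_closed psl2.G.inv_closed)
  have "psl2 ?Q = \<one>\<^bsub>PSL2\<^esub> \<longleftrightarrow> psl2 A = psl2 B"
  proof -
    have AB: "psl2 A \<in> carrier PSL2" "psl2 B \<in> carrier PSL2" using assms by (simp_all only: psl2.hom_closed)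
    then have "inv\<^bsub>PSL2\<^esub> psl2 A \<otimes>\<^bsub>PSL2\<^esub> psl2 B = \<one>\<^bsub>PSL2\<^esub> \<longleftrightarrow> psl2 A = psl2 B"
      by (metis psl2.H.inv_closed psl2.H.inv_equality psl2.H.inv_inv psl2.H.l_inv)
    then show ?thesis using psl2_quotient[OF assms] by simp
  qed
  then show ?thesis
    unfolding psl2_quotient[OF assms] psl2_cube_iff[OF Q] mat2_form_eq_tr[OF assms(1)]
    using psl2_eq_one_iff[of ?Q] by blast
qed

text \<open>The two lifts A and -A have opposite traces 1 and -1, so the sign can be chosen.\<close>

lemma PSL2_order_3_trace_1:
  assumes x: "x \<in> carrier (PSL2 :: 'a::field mat2 set monoid)"
    and cube: "x [^]\<^bsub>PSL2\<^esub> (3::nat) = \<one>\<^bsub>PSL2\<^esub>" and "x \<noteq> \<one>\<^bsub>PSL2\<^esub>"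
  shows "\<exists>A\<in>carrier SL2. mat2_tr A = 1 \<and> x = psl2 A"
proof -
  obtain A where A: "A \<in> carrier SL2" "x = psl2 A" using x PSL2_carrier by blast
  then have tr: "mat2_tr A = 1 \<or> mat2_tr A = - 1"
    using assms psl2_cube_iff[OF A(1)] psl2_eq_one_iff[of A] by blast
  obtain a b c d where abcd: "A = (a,b,c,d)" by (cases A)
  show ?thesis
  proof (cases "mat2_tr A = 1")
    case False
    have "mat2_tr (-a,-b,-c,-d) = - mat2_tr A" by (simp add: mat2_tr_def abcd)
    then have "mat2_tr (-a,-b,-c,-d) = 1" using tr False by simp
    moreover have "(-a,-b,-c,-d) \<in> carrier SL2" using A abcd by (simp add: mat2_det_def)
    moreover have "psl2 (-a,-b,-c,-d) = psl2 A" by (auto simp: psl2_eq abcd)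
    ultimately show ?thesis using A by blast
  qed (use A in blast)
qed

text \<open>The characteristic polynomial X^2 - X + 1 has the roots \<zeta> and 1 - \<zeta>, which
  differ because its discriminant -3 is nonzero. So there is a basis of eigenvectors.\<close>

lemma SL2_diagonalise:
  fixes \<zeta> :: "'a::field"
  assumes three: "(3::'a) \<noteq> 0" and \<zeta>: "\<zeta> * (1 - \<zeta>) = 1"
    and A: "A \<in> carrier SL2" "mat2_tr A = 1"
  shows "\<exists>P\<in>carrier SL2. A \<otimes>\<^bsub>SL2\<^esub> P = P \<otimes>\<^bsub>SL2\<^esub> (\<zeta>,0,0,1-\<zeta>)"
proof -
  have "snd (snd (snd A)) = 1 - fst A" using A(2) by (cases A) (auto simp: mat2_tr_def algebra_simps)
  then obtain a b c where abc: "A = (a,b,c,1-a)" by (cases A) auto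
  have det: "a * (1 - a) - b * c = 1" using A abc by (simp add: mat2_det_def)
  have disc: "2 * \<zeta> - 1 \<noteq> 0"
  proof
    assume "2 * \<zeta> - 1 = 0"
    moreover have "(2 * \<zeta> - 1) * (2 * \<zeta> - 1) = 1 - 4 * (\<zeta> * (1 - \<zeta>))" by (simp add: algebra_simps)
    ultimately show False using three \<zeta> by simp
  qed
  \<comment> \<open>The columns (x, y) and (u, z) are eigenvectors for \<zeta> and 1 - \<zeta>;
    dividing the first by \<delta> gives P determinant 1.\<close>
  have eigen: ?thesis
    if v: "a * x + b * y = \<zeta> * x" "c * x + (1 - a) * y = \<zeta> * y"
      and w: "a * u + b * z = (1 - \<zeta>) * u" "c * u + (1 - a) * z = (1 - \<zeta>) * z"
      and nz: "x * z - u * y \<noteq> 0" for x y u z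
  proof -
    define \<delta> where "\<delta> = x * z - u * y"
    have \<delta>: "\<delta> \<noteq> 0" using nz by (simp add: \<delta>_def)
    have "a * (x / \<delta>) + b * (y / \<delta>) = \<zeta> * (x / \<delta>)" "c * (x / \<delta>) + (1 - a) * (y / \<delta>) = \<zeta> * (y / \<delta>)"
      using v by (simp_all add: add_divide_distrib[symmetric])
    moreover have "x / \<delta> * z - u * (y / \<delta>) = 1"
    proof -
      have "x / \<delta> * z - u * (y / \<delta>) = (x * z - u * y) / \<delta>" by (simp add: diff_divide_distrib)
      then show ?thesis using \<delta> by (simp add: \<delta>_def)
    qed
    ultimately show ?thesis
      using w by (intro bexI[of _ "(x / \<delta>, u, y / \<delta>, z)"])
        (auto simp: abc mat2_mult_def mat2_det_def mult.commute)
  qed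
  show ?thesis
  proof (cases "c = 0")
    case False
    \<comment> \<open>By Cayley-Hamilton the first columns of A - (1 - \<zeta>) and A - \<zeta> are
      eigenvectors for \<zeta> and 1 - \<zeta>.\<close>
    have "(a - 1 + \<zeta>) * c - (a - \<zeta>) * c = c * (2 * \<zeta> - 1)" by (simp add: algebra_simps)
    then have nz: "(a - 1 + \<zeta>) * c - (a - \<zeta>) * c \<noteq> 0" using False disc by simp
    have "a * (a - 1 + \<zeta>) + b * c - \<zeta> * (a - 1 + \<zeta>) = \<zeta> * (1 - \<zeta>) - (a * (1 - a) - b * c)"
      "a * (a - \<zeta>) + b * c - (1 - \<zeta>) * (a - \<zeta>) = \<zeta> * (1 - \<zeta>) - (a * (1 - a) - b * c)"
      by (simp_all add: algebra_simps)
    then have "a * (a - 1 + \<zeta>) + b * c = \<zeta> * (a - 1 + \<zeta>)" "a * (a - \<zeta>) + b * c = (1 - \<zeta>) * (a - \<zeta>)"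
      using det \<zeta> by simp_all
    moreover have "c * (a - 1 + \<zeta>) + (1 - a) * c = \<zeta> * c" "c * (a - \<zeta>) + (1 - a) * c = (1 - \<zeta>) * c"
      by (simp_all add: algebra_simps)
    ultimately show ?thesis using nz by (intro eigen[of "a - 1 + \<zeta>" c "a - \<zeta>" c]) simp_all
  next
    case True
    \<comment> \<open>A is upper triangular here, so its diagonal entries are the two eigenvalues in
      some order.\<close>
    have "(a - \<zeta>) * (a - (1 - \<zeta>)) = \<zeta> * (1 - \<zeta>) - a * (1 - a)" by (simp add: algebra_simps)
    then have "(a - \<zeta>) * (a - (1 - \<zeta>)) = 0" using det \<zeta> True by simp
    then consider "a = \<zeta>" | "a = 1 - \<zeta>" by auto
    then show ?thesis
    proof cases
      case 1
      show ?thesis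
        by (rule eigen[of 1 0 b "1 - 2 * \<zeta>"]) (use 1 True disc in \<open>auto simp: algebra_simps\<close>)
    next
      case 2
      show ?thesis
        by (rule eigen[of b "2 * \<zeta> - 1" 1 0]) (use True disc in \<open>auto simp: 2 algebra_simps\<close>)
    qed
  qed
qed

lemma PSL2_order_3_conjugate:
  fixes \<zeta> :: "'a::field"
  assumes three: "(3::'a) \<noteq> 0" and \<zeta>: "\<zeta> * (1 - \<zeta>) = 1"
    and x: "x \<in> carrier PSL2" "x [^]\<^bsub>PSL2\<^esub> (3::nat) = \<one>\<^bsub>PSL2\<^esub>" "x \<noteq> \<one>\<^bsub>PSL2\<^esub>"
  shows "\<exists>u\<in>carrier PSL2. inv\<^bsub>PSL2\<^esub> u \<otimes>\<^bsub>PSL2\<^esub> x \<otimes>\<^bsub>PSL2\<^esub> u = psl2 (\<zeta>,0,0,1-\<zeta>)"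
proof -
  interpret psl2: group_hom SL2 PSL2 "psl2 :: 'a mat2 \<Rightarrow> _" by (rule psl2_hom)
  obtain A where A: "A \<in> carrier SL2" "mat2_tr A = 1" "x = psl2 A"
    using PSL2_order_3_trace_1[OF x] by blast
  obtain P where P: "P \<in> carrier SL2" "A \<otimes>\<^bsub>SL2\<^esub> P = P \<otimes>\<^bsub>SL2\<^esub> (\<zeta>,0,0,1-\<zeta>)"
    using SL2_diagonalise[OF three \<zeta> A(1,2)] by blast
  have D: "(\<zeta>,0,0,1-\<zeta>) \<in> carrier SL2" using \<zeta> by (simp add: mat2_det_def)
  have car: "psl2 P \<in> carrier PSL2" "psl2 (\<zeta>,0,0,1-\<zeta>) \<in> carrier PSL2"
    by (rule psl2.hom_closed[OF P(1)], rule psl2.hom_closed[OF D])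
  have "x \<otimes>\<^bsub>PSL2\<^esub> psl2 P = psl2 P \<otimes>\<^bsub>PSL2\<^esub> psl2 (\<zeta>,0,0,1-\<zeta>)"
    unfolding A(3) psl2.hom_mult[OF A(1) P(1), symmetric] psl2.hom_mult[OF P(1) D, symmetric] P(2) ..
  then have "inv\<^bsub>PSL2\<^esub> psl2 P \<otimes>\<^bsub>PSL2\<^esub> x \<otimes>\<^bsub>PSL2\<^esub> psl2 P = psl2 (\<zeta>,0,0,1-\<zeta>)"
    using x(1) car by (metis psl2.H.inv_closed psl2.H.inv_solve_left psl2.H.m_assoc psl2.H.m_closed)
  then show ?thesis using car by blast
qed

text \<open>Used for the lower bounds: it suffices to check each pair of an explicit list once, the
  form being symmetric. The images are distinct, since A and B equal up to sign would have polar
  form 2 or -2, which differs from 1 and -1 when 3 is nonzero.\<close>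

lemma psl2_clique:
  fixes xs :: "'a::field mat2 list"
  assumes three: "(3::'a) \<noteq> 0" and xs: "set xs \<subseteq> carrier SL2"
    and form: "sorted_wrt (\<lambda>A B. mat2_form A B \<in> {1,-1}) xs"
  shows "psl2 ` set xs \<subseteq> carrier PSL2" "card (psl2 ` set xs) = length xs"
    and "\<And>g h. g \<in> psl2 ` set xs \<Longrightarrow> h \<in> psl2 ` set xs \<Longrightarrow>
      (inv\<^bsub>PSL2\<^esub> g \<otimes>\<^bsub>PSL2\<^esub> h) [^]\<^bsub>PSL2\<^esub> (3::nat) = \<one>\<^bsub>PSL2\<^esub>"
proof -
  show "psl2 ` set xs \<subseteq> carrier PSL2" using xs by (auto simp only: PSL2_carrier)
  have ne: "psl2 A \<noteq> psl2 B" if "mat2_det A = 1" "mat2_form A B \<in> {1,-1}" for A B :: "'a mat2"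
  proof
    assume eq: "psl2 A = psl2 B"
    obtain a b c d where A: "A = (a,b,c,d)" by (cases A)
    have "B \<in> psl2 A" unfolding eq by (cases B) (simp add: psl2_eq)
    then have "mat2_form A B = 2 * mat2_det A \<or> mat2_form A B = - (2 * mat2_det A)"
      by (auto simp: A psl2_eq mat2_form_def mat2_det_def algebra_simps)
    moreover have "(1::'a) \<noteq> 2" by (metis add_cancel_right_right one_add_one zero_neq_one)
    moreover from this have "(1::'a) \<noteq> - 2" "(- 1::'a) \<noteq> 2" "(- 1::'a) \<noteq> - 2"
      using three by (simp_all add: eq_neg_iff_add_eq_0 neg_eq_iff_add_eq_0)
    ultimately show False using that by auto
  qed
  have "distinct (map psl2 xs)"
    using xs form by (induction xs) (auto dest!: ne)
  then show "card (psl2 ` set xs) = length xs"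
    using distinct_card[of "map psl2 xs"] by simp
  have pair: "A = B \<or> mat2_form A B \<in> {1,-1}" if "A \<in> set xs" "B \<in> set xs" for A B
    using form that by (induction xs) (auto simp: mat2_form_sym)
  show "(inv\<^bsub>PSL2\<^esub> g \<otimes>\<^bsub>PSL2\<^esub> h) [^]\<^bsub>PSL2\<^esub> (3::nat) = \<one>\<^bsub>PSL2\<^esub>"
    if gh: "g \<in> psl2 ` set xs" "h \<in> psl2 ` set xs" for g h
  proof -
    obtain A B where AB: "A \<in> set xs" "g = psl2 A" "B \<in> set xs" "h = psl2 B" using gh by blast
    then have "A \<in> carrier SL2" "B \<in> carrier SL2" using xs by blast+
    from psl2_quotient_cube_iff[OF this] pair[OF AB(1,3)] show ?thesis
      unfolding AB by blast
  qed
qed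

text \<open>Used for the upper bounds. Left translation by the inverse of one member
  \<open>g0\<close> keeps all mutual quotients and moves \<open>g0\<close> to the identity, so the
  others acquire lifts of trace 1. This costs one element, hence the strict inequality.\<close>

lemma clique_representatives:
  fixes S :: "'a::field mat2 set set"
  assumes S: "S \<subseteq> carrier PSL2"
    and clique: "\<And>g h. g \<in> S \<Longrightarrow> h \<in> S \<Longrightarrow>
      (inv\<^bsub>PSL2\<^esub> g \<otimes>\<^bsub>PSL2\<^esub> h) [^]\<^bsub>PSL2\<^esub> (3::nat) = \<one>\<^bsub>PSL2\<^esub>"
    and n: "n < card S"
  shows "\<exists>A :: nat \<Rightarrow> 'a mat2. (\<forall>i<n. mat2_det (A i) = 1 \<and> mat2_tr (A i) = 1) \<and>
    (\<forall>i<n. \<forall>j<n. i \<noteq> j \<longrightarrow> mat2_form (A i) (A j) \<in> {1,-1})"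
proof -
  interpret psl2: group_hom SL2 PSL2 "psl2 :: 'a mat2 \<Rightarrow> _" by (rule psl2_hom)
  have fin: "finite S" using n card.infinite by fastforce
  then obtain g0 where g0: "g0 \<in> S" using n by fastforce
  have g0c: "g0 \<in> carrier PSL2" using g0 S by blast
  have "card (S - {g0}) \<ge> n" using n g0 fin by simp
  then obtain f where f: "f ` {..<n} \<subseteq> S - {g0}" "inj_on f {..<n}"
    using fin card_le_inj[of "{..<n}" "S - {g0}"] by auto
  have fc: "f i \<in> S" "f i \<noteq> g0" "f i \<in> carrier PSL2" if "i < n" for i using f(1) S that by auto
  have "\<exists>A\<in>carrier SL2. mat2_tr A = 1 \<and> inv\<^bsub>PSL2\<^esub> g0 \<otimes>\<^bsub>PSL2\<^esub> f i = psl2 A" if i: "i < n" for i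
  proof (rule PSL2_order_3_trace_1)
    show "inv\<^bsub>PSL2\<^esub> g0 \<otimes>\<^bsub>PSL2\<^esub> f i \<in> carrier PSL2" using g0c fc[OF i] by simp
    show "inv\<^bsub>PSL2\<^esub> g0 \<otimes>\<^bsub>PSL2\<^esub> f i \<noteq> \<one>\<^bsub>PSL2\<^esub>"
      using g0c fc[OF i] by (metis psl2.H.inv_closed psl2.H.inv_equality psl2.H.inv_inv)
  qed (use clique g0 fc[OF i] in simp)
  then obtain A where A: "\<And>i. i < n \<Longrightarrow> A i \<in> carrier SL2" "\<And>i. i < n \<Longrightarrow> mat2_tr (A i) = 1"
      "\<And>i. i < n \<Longrightarrow> inv\<^bsub>PSL2\<^esub> g0 \<otimes>\<^bsub>PSL2\<^esub> f i = psl2 (A i)"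
    by metis
  have cancel: "g0 \<otimes>\<^bsub>PSL2\<^esub> (inv\<^bsub>PSL2\<^esub> g0 \<otimes>\<^bsub>PSL2\<^esub> x) = x" if "x \<in> carrier PSL2" for x
    using g0c that by (simp add: psl2.H.m_assoc[symmetric])
  have pm: "mat2_form (A i) (A j) \<in> {1,-1}" if ij: "i < n" "j < n" "i \<noteq> j" for i j
  proof -
    have "inv\<^bsub>PSL2\<^esub> psl2 (A i) \<otimes>\<^bsub>PSL2\<^esub> psl2 (A j)
        = inv\<^bsub>PSL2\<^esub> f i \<otimes>\<^bsub>PSL2\<^esub> f j"
      unfolding A(3)[OF ij(1), symmetric] A(3)[OF ij(2), symmetric]
      using fc ij g0c cancel by (simp add: psl2.H.inv_mult_group psl2.H.m_assoc)
    then have "(inv\<^bsub>PSL2\<^esub> psl2 (A i) \<otimes>\<^bsub>PSL2\<^esub> psl2 (A j)) [^]\<^bsub>PSL2\<^esub> (3::nat) = \<one>\<^bsub>PSL2\<^esub>"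
      using clique fc ij by simp
    moreover have "psl2 (A i) \<noteq> psl2 (A j)"
    proof -
      have "f i \<noteq> f j" using f(2) ij by (auto dest: inj_onD)
      then show ?thesis
        unfolding A(3)[OF ij(1), symmetric] A(3)[OF ij(2), symmetric] using fc ij g0c by simp
    qed
    ultimately show ?thesis using psl2_quotient_cube_iff[OF A(1)[OF ij(1)] A(1)[OF ij(2)]] by blast
  qed
  have det: "mat2_det (A i) = 1" if "i < n" for i using A(1)[OF that] by simp
  show ?thesis using det A(2) pm by blast
qed

section \<open>The intersection density\<close>

theorem theorem6p1:
  fixes p e :: nat and H :: "'a::field mat2 set set"
  assumes "finite (UNIV :: 'a set)"
    and "Factorial_Ring.prime p" and "e \<ge> 1" and "card (UNIV :: 'a set) = p ^ e"
    and "p ^ e mod 3 = 1"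
    and "subgroup H (PSL2 :: 'a mat2 set monoid)" and "card H = 3"
  shows "intersection_density (coset_space PSL2 H) (coset_perm_group PSL2 H)
           = (if p \<noteq> 5 then 4 / 3 else 2)"
proof -
  interpret psl2: group_hom SL2 PSL2 "psl2 :: 'a mat2 \<Rightarrow> _" by (rule psl2_hom)
  \<comment> \<open>The characteristic is identified with \<open>p\<close> by showing that
    \<open>p\<close> vanishes in the field and no other prime does.\<close>
  have char_dvd: "CHAR('a) dvd p ^ e" using CHAR_dvd_CARD[where 'a = 'a] assms(4) by simp
  then have "of_nat (p ^ e) = (0::'a)" by (simp only: of_nat_eq_0_iff_char_dvd)
  then have p0: "of_nat p = (0::'a)" by (simp add: power_eq_0_iff)
  have other: "of_nat r \<noteq> (0::'a)" if "Factorial_Ring.prime r" "r \<noteq> p" for r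
  proof
    assume "of_nat r = (0::'a)"
    then have "CHAR('a) dvd r" by (simp only: of_nat_eq_0_iff_char_dvd)
    moreover have "CHAR('a) dvd p" using p0 by (simp only: of_nat_eq_0_iff_char_dvd)
    moreover have "coprime r p" using that assms(2) by (simp add: primes_coprime)
    ultimately have "is_unit CHAR('a)" by (rule coprime_common_divisor[rotated 1])
    then show False using CHAR_not_1[where 'a = 'a] by simp
  qed
  have "p \<noteq> 3" using assms(3,5) by (cases e) auto
  then have three: "(3::'a) \<noteq> 0" using other[of 3] by simp
  have five: "(5::'a) = 0 \<longleftrightarrow> p = 5" using other[of 5] p0 by (cases "p = 5") auto
  obtain \<zeta> :: 'a where \<zeta>: "\<zeta> * (1 - \<zeta>) = 1"
    using primitive_sixth_root_exists[OF assms(1)] assms(4,5) by auto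
  \<comment> \<open>This is the solution of \<open>za\<close>: a matrix with diagonal (a, 1-a) then
    has polar form 1 with diag(\<zeta>, 1-\<zeta>). Since a (1-a) = 1/3, determinant 1 means that
    the off-diagonal entries have product -2/3.\<close>
  define a where "a = (1 + \<zeta>) / 3"
  define xs :: "'a mat2 list" where
    "xs = [(1,0,0,1), (\<zeta>,0,0,1-\<zeta>), (a,1,-2/3,1-a), (a,-2,1/3,1-a)]"
  have zz: "\<zeta> * \<zeta> = \<zeta> - 1" using \<zeta> by (simp add: algebra_simps)
  have a3: "3 * a = 1 + \<zeta>" using three by (simp add: a_def)
  have aa: "a * (1 - a) = 1 / 3"
  proof -
    have "3 * (3 * (a * (1 - a))) = (3 * a) * (3 - 3 * a)" by (simp add: algebra_simps)
    also have "\<dots> = 3 * 1" unfolding a3 using zz by (simp add: algebra_simps)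
    finally have "3 * (a * (1 - a)) = 1" using three by (simp only: mult_cancel_left) simp
    then show ?thesis using three by (simp add: eq_divide_eq mult.commute)
  qed
  have za: "\<zeta> * (1 - a) + (1 - \<zeta>) * a = 1"
  proof -
    have "3 * (\<zeta> * (1 - a) + (1 - \<zeta>) * a) = \<zeta> * (3 - 3 * a) + (1 - \<zeta>) * (3 * a)"
      by (simp add: algebra_simps)
    also have "\<dots> = 2 * (\<zeta> - \<zeta> * \<zeta>) + 1" unfolding a3 by (simp add: algebra_simps)
    also have "\<dots> = 3 * 1" unfolding zz by simp
    finally show ?thesis using three by (simp only: mult_cancel_left) simp
  qed
  have xs_car: "set xs \<subseteq> carrier SL2"
    using \<zeta> aa three by (auto simp: xs_def mat2_det_def field_simps)
  have form: "mat2_form (a,y,z,1-a) (a,y',z',1-a) = 2 * (a * (1 - a)) - y * z' - z * y'" for y z y' z'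
    by (simp add: mat2_form_def algebra_simps)
  have form1: "mat2_form (1,0,0,1) (x,y,z,1-x) = 1" for x y z :: 'a
    by (simp add: mat2_form_def)
  have form\<zeta>: "mat2_form (\<zeta>,0,0,1-\<zeta>) (a,y,z,1-a) = 1" for y z
    using za by (simp add: mat2_form_def algebra_simps)
  have xs_form: "sorted_wrt (\<lambda>A B. mat2_form A B \<in> {1,-1}) xs"
  proof -
    have "mat2_form (a,1,-2/3,1-a) (a,-2,1/3,1-a) = - 1"
      unfolding form aa using three by (simp add: field_simps)
    then show ?thesis by (simp add: xs_def form1 form\<zeta>)
  qed
  note xs_clique = psl2_clique[OF three xs_car xs_form]
  have fin: "finite (carrier (PSL2 :: 'a mat2 set monoid))"
  proof -
    have "finite (UNIV :: 'a mat2 set)" by (intro finite_Prod_UNIV assms(1))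
    then show ?thesis unfolding PSL2_carrier by (intro finite_imageI) (rule finite_subset[OF subset_UNIV])
  qed
  interpret conjugate_cube_roots PSL2 H
  proof (intro conjugate_cube_roots.intro conjugate_cube_roots_axioms.intro)
    show "group (PSL2 :: 'a mat2 set monoid)" by (rule psl2.H.is_group)
    show sub: "subgroup H PSL2" and card3: "card H = 3" by fact+
    show "\<exists>u\<in>carrier PSL2. inv\<^bsub>PSL2\<^esub> u \<otimes>\<^bsub>PSL2\<^esub> x \<otimes>\<^bsub>PSL2\<^esub> u \<in> H"
      if x: "x \<in> carrier PSL2" "x [^]\<^bsub>PSL2\<^esub> (3::nat) = \<one>\<^bsub>PSL2\<^esub>" for x
    proof (cases "x = \<one>\<^bsub>PSL2\<^esub>")
      case True
      then show ?thesis
        using subgroup.one_closed[OF sub] by (intro bexI[of _ "\<one>\<^bsub>PSL2\<^esub>"]) simp_all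
    next
      case False
      \<comment> \<open>Both \<open>x\<close> and some nontrivial \<open>y\<close> in
        \<open>H\<close> are conjugate to the same diagonal element, hence to each other.\<close>
      have "\<not> H \<subseteq> {\<one>\<^bsub>PSL2\<^esub>}" using card3 card_mono[of "{\<one>\<^bsub>PSL2\<^esub>}" H] by auto
      then obtain y where y: "y \<in> H" "y \<noteq> \<one>\<^bsub>PSL2\<^esub>" by blast
      have yc: "y \<in> carrier PSL2" using subgroup.mem_carrier[OF sub y(1)] .
      obtain u where u: "u \<in> carrier PSL2"
          "inv\<^bsub>PSL2\<^esub> u \<otimes>\<^bsub>PSL2\<^esub> x \<otimes>\<^bsub>PSL2\<^esub> u = psl2 (\<zeta>,0,0,1-\<zeta>)"
        using PSL2_order_3_conjugate[OF three \<zeta> x False] by blast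
      obtain v where v: "v \<in> carrier PSL2"
          "inv\<^bsub>PSL2\<^esub> v \<otimes>\<^bsub>PSL2\<^esub> y \<otimes>\<^bsub>PSL2\<^esub> v = psl2 (\<zeta>,0,0,1-\<zeta>)"
        using PSL2_order_3_conjugate[OF three \<zeta> yc psl2.H.subgroup_card_3_cube[OF sub card3 y(1)] y(2)]
        by blast
      let ?w = "u \<otimes>\<^bsub>PSL2\<^esub> inv\<^bsub>PSL2\<^esub> v"
      have "inv\<^bsub>PSL2\<^esub> ?w \<otimes>\<^bsub>PSL2\<^esub> x \<otimes>\<^bsub>PSL2\<^esub> ?w
          = v \<otimes>\<^bsub>PSL2\<^esub> (inv\<^bsub>PSL2\<^esub> u \<otimes>\<^bsub>PSL2\<^esub> x \<otimes>\<^bsub>PSL2\<^esub> u) \<otimes>\<^bsub>PSL2\<^esub> inv\<^bsub>PSL2\<^esub> v"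
        using u(1) v(1) x(1) by (simp add: psl2.H.inv_mult_group psl2.H.m_assoc)
      also have "\<dots> = y" unfolding u(2) v(2)[symmetric] by (rule psl2.H.conj_cancel(2)[OF v(1) yc])
      finally show ?thesis using y(1) u(1) v(1) by (intro bexI[of _ ?w]) simp_all
    qed
    \<comment> \<open>The four-element intersecting set contains the identity, so all its members
      have trivial cube, which gives more than three.\<close>
    have one: "\<one>\<^bsub>PSL2\<^esub> \<in> psl2 ` set xs"
      using psl2_eq_one_iff[of "(1,0,0,1) :: 'a mat2"] by (simp add: xs_def)
    have "h [^]\<^bsub>PSL2\<^esub> (3::nat) = \<one>\<^bsub>PSL2\<^esub>" if "h \<in> psl2 ` set xs" for h
    proof -
      have "h \<in> carrier PSL2" using xs_clique(1) that by blast
      then show ?thesis using xs_clique(3)[OF one that] by simp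
    qed
    then have "psl2 ` set xs \<subseteq> {x \<in> carrier PSL2. x [^]\<^bsub>PSL2\<^esub> (3::nat) = \<one>\<^bsub>PSL2\<^esub>}"
      using xs_clique(1) by blast
    then have "card (psl2 ` set xs) \<le> card {x \<in> carrier PSL2. x [^]\<^bsub>PSL2\<^esub> (3::nat) = \<one>\<^bsub>(PSL2 :: 'a mat2 set monoid)\<^esub>}"
      using fin by (intro card_mono) auto
    moreover have "card (psl2 ` set xs) = 4" unfolding xs_clique(2) by (simp add: xs_def)
    ultimately show "card {x \<in> carrier PSL2. x [^]\<^bsub>PSL2\<^esub> (3::nat) = \<one>\<^bsub>(PSL2 :: 'a mat2 set monoid)\<^esub>} > 3"
      by simp
  qed
  show ?thesis
  proof (cases "p = 5")
    case False
    have "intersection_density (coset_space PSL2 H) (coset_perm_group PSL2 H) = real 4 / 3"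
    proof (rule intersection_density_eq[OF _ xs_clique(1,3)])
      show "card (psl2 ` set xs) = 4" unfolding xs_clique(2) by (simp add: xs_def)
      show "card S \<le> 4" if S: "S \<subseteq> carrier PSL2"
        "\<And>g h. g \<in> S \<Longrightarrow> h \<in> S \<Longrightarrow> (inv\<^bsub>PSL2\<^esub> g \<otimes>\<^bsub>PSL2\<^esub> h) [^]\<^bsub>PSL2\<^esub> (3::nat) = \<one>\<^bsub>PSL2\<^esub>" for S :: "'a mat2 set set"
      proof (rule ccontr)
        assume "\<not> card S \<le> 4"
        \<comment> \<open>Five elements leave four trace 1 matrices after translation.\<close>
        then obtain A :: "nat \<Rightarrow> 'a mat2" where
          A: "\<forall>i<4. mat2_det (A i) = 1 \<and> mat2_tr (A i) = 1"
            "\<forall>i<4. \<forall>j<4. i \<noteq> j \<longrightarrow> mat2_form (A i) (A j) \<in> {1,-1}"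
          using clique_representatives[OF S, of 4] by auto
        have "(5::'a) = 0" by (rule conjunct1[OF four_trace_1[OF three, of A]]) (use A in auto)
        then show False using five False by blast
      qed
    qed
    then show ?thesis using False by simp
  next
    case True
    then have five0: "(5::'a) = 0" using five by simp
    have "(6::'a) = 5 + 1" "(4::'a) = 5 + - 1" by simp_all
    then have num: "(6::'a) = 1" "(4::'a) = - 1" unfolding five0 by simp_all
    have "1 / 3 = (2::'a)" using three by (simp add: divide_eq_eq num)
    with aa have aa2: "a * (1 - a) = 2" by (rule trans)
    \<comment> \<open>In characteristic 5 the off-diagonal product -2/3 is 1, and the upper right
      entry runs through the four nonzero elements of the prime field, with its inverse at the lower
      left.\<close>
    define ys :: "'a mat2 list" where
      "ys = [(1,0,0,1), (\<zeta>,0,0,1-\<zeta>), (a,1,1,1-a), (a,-2,2,1-a), (a,2,-2,1-a), (a,-1,-1,1-a)]"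
    have ys_car: "set ys \<subseteq> carrier SL2"
      using \<zeta> aa2 num by (simp add: ys_def mat2_det_def)
    have ys_form: "sorted_wrt (\<lambda>A B. mat2_form A B \<in> {1,-1}) ys"
      by (simp add: ys_def form1 form\<zeta>) (simp add: form aa2 num)
    note ys_clique = psl2_clique[OF three ys_car ys_form]
    have "intersection_density (coset_space PSL2 H) (coset_perm_group PSL2 H) = real 6 / 3"
    proof (rule intersection_density_eq[OF _ ys_clique(1,3)])
      show "card (psl2 ` set ys) = 6" unfolding ys_clique(2) by (simp add: ys_def)
      show "card S \<le> 6" if S: "S \<subseteq> carrier PSL2"
        "\<And>g h. g \<in> S \<Longrightarrow> h \<in> S \<Longrightarrow> (inv\<^bsub>PSL2\<^esub> g \<otimes>\<^bsub>PSL2\<^esub> h) [^]\<^bsub>PSL2\<^esub> (3::nat) = \<one>\<^bsub>PSL2\<^esub>" for S :: "'a mat2 set set"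
      proof (rule ccontr)
        assume "\<not> card S \<le> 6"
        then obtain A :: "nat \<Rightarrow> 'a mat2" where
          A: "\<forall>i<6. mat2_det (A i) = 1 \<and> mat2_tr (A i) = 1"
            "\<forall>i<6. \<forall>j<6. i \<noteq> j \<longrightarrow> mat2_form (A i) (A j) \<in> {1,-1}"
          using clique_representatives[OF S, of 6] by auto
        show False by (rule no_six_trace_1[OF three, of A]) (use A in auto)
      qed
    qed
    then show ?thesis using True by simp
  qed
qed

end
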